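(* Let $r>0$, $0<p\le1$. There is a constant $c_r'>0$ depending only on $r$ such that for all $d\in\mathbb{N}$ and all $n\in\mathbb{N}$ with $n+1<e^{d/8}/2$, $$\mathrm{err}^{\mathrm{ran}}(n,R_d^{r,p})\ \ge\ c_r'\left(\frac{1}{8\log(4(n+1))}\right)^{r(1/p-1)}.$$
   Context: $\|a\|_p=(\sum_{i=1}^d|a_i|^p)^{1/p}$. For $r>0$ let $m$ be the largest integer strictly less than $r$ and $\beta=r-m\in(0,1]$. $B^{\mathrm{Lip}(r)}$ is the set of all $m$ times continuously differentiable $g:[-1,1]\to\mathbb{R}$ with $\max\{\|g\|_\infty,\|g^{(1)}\|_\infty,\dots,\|g^{(m)}\|_\infty,|g^{(m)}|_\beta\}\le 1$, where $|g^{(m)}|_\beta=\sup_{u\ne v\in[-1,1]}\frac{|g^{(m)}(u)-g^{(m)}(v)|}{2\min\{1,|u-v|\}^\beta}$. $R_d^{r,p}=\{f:[-1,1]^d\to\mathbb{R}:\ f(x)=g(a^{T}x),\ g\in B^{\mathrm{Lip}(r)},\ a\in\mathbb{R}^d,\ \|a\|_p=1\}$. Randomized algorithms. Let $F_d\subset C([-1,1]^d)$. A randomized algorithm using at most $n$ function values is given by a probability space $(\Omega,\mathfrak{A},\mathbb{P})$ and a map $S_n:\Omega\times F_d\to C([-1,1]^d)$ with $S_n(\omega,f)=\phi(\omega,f(X_1(\omega)),\dots,f(X_n(\omega)))$, where $\phi:\Omega\times\mathbb{R}^n\to C([-1,1]^d)$ is measurable in the first argument with respect to $\mathfrak{A}$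 and Borel measurable in the last $n$ arguments, and $X_1,\dots,X_n$ are $[-1,1]^d$-valued random variables on $(\Omega,\mathfrak{A},\mathbb{P})$ (adaptively chosen random sampling points) such that $X_1$ does not depend on $f$ and for each $i=2,\dots,n$ there is a map $L_i:\Omega\times\mathbb{R}^{i-1}\to[-1,1]^d$ (not depending on $f$) with $L_i(\omega,\cdot)$ Borel measurable for every $\omega\in\Omega$ and $X_i(\omega)=L_i(\omega,f(X_1(\omega)),\dots,f(X_{i-1}(\omega)))$. The $n$th minimal worst-case error in the randomized setting is $$\mathrm{err}^{\mathrm{ran}}(n,F_d)=\inf_{S_n}\sup_{f\in F_d}\big(\mathbb{E}\,\|f-S_n(f)\|_\infty^2\big)^{1/2},$$ the infimum being over all such randomized algorithms. *)

theory Defs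
  imports "HOL-Probability.Probability"
begin

section \<open>The cube and its continuous functions\<close>

text \<open>
  The dimension \<open>d\<close> is quantified inside the statement, so vectors in \<open>\<real>\<^sup>d\<close> are functions
  \<open>nat \<Rightarrow> real\<close>, \<^const>\<open>undefined\<close> outside \<open>{..<d}\<close>. Indices start at 0.
\<close>

type_synonym vec = "nat \<Rightarrow> real"

definition cube :: "nat \<Rightarrow> vec set" where
  "cube d = {..<d} \<rightarrow>\<^sub>E {-1..1}"

definition cube_top :: "nat \<Rightarrow> vec topology" where
  "cube_top d = product_topology (\<lambda>_. top_of_set {-1..1}) {..<d}"

definition cube_borel :: "nat \<Rightarrow> vec measure" where
  "cube_borel d = Pi\<^sub>M {..<d} (\<lambda>_. restrict_space borel {-1..1})"

definition vec_borel :: "nat \<Rightarrow> vec measure" where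
  "vec_borel n = Pi\<^sub>M {..<n} (\<lambda>_. borel)"

text \<open>\<open>C([-1,1]\<^sup>d)\<close> with the distance \<open>\<parallel>f - g\<parallel>\<^sub>\<infinity>\<close>, and the Borel sets of this metric.\<close>

definition C_cube :: "nat \<Rightarrow> (vec \<Rightarrow> real) metric" where
  "C_cube d = cfunspace (cube_top d) euclidean_metric"

definition C_borel :: "nat \<Rightarrow> (vec \<Rightarrow> real) measure" where
  "C_borel d = sigma (mspace (C_cube d)) {U. openin (mtopology_of (C_cube d)) U}"

section \<open>Ridge functions\<close>

definition lip_order :: "real \<Rightarrow> nat" where
  "lip_order r = nat (\<lceil>r\<rceil> - 1)"

text \<open>
  \<open>D k\<close> is the \<open>k\<close>-th derivative of \<open>g\<close> on \<open>[-1,1]\<close>, one-sided at the endpoints. Only the values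
  of \<open>g\<close> on \<open>[-1,1]\<close> matter. The suprema bounded by 1 are stated pointwise because \<^const>\<open>Sup\<close> on
  \<^typ>\<open>real\<close> is unspecified for unbounded sets.
\<close>

definition lip_ball :: "real \<Rightarrow> (real \<Rightarrow> real) set" where
  "lip_ball r =
    (let m = lip_order r; \<beta> = r - real m in
     {g. \<exists>D :: nat \<Rightarrow> real \<Rightarrow> real.
       (\<forall>t\<in>{-1..1}. D 0 t = g t) \<and>
       (\<forall>k<m. \<forall>t\<in>{-1..1}. (D k has_real_derivative D (Suc k) t) (at t within {-1..1})) \<and>
       continuous_on {-1..1} (D m) \<and>
       (\<forall>k\<le>m. \<forall>t\<in>{-1..1}. \<bar>D k t\<bar> \<le> 1) \<and>
       (\<forall>u\<in>{-1..1}. \<forall>v\<in>{-1..1}. u \<noteq> v \<longrightarrow>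
          \<bar>D m u - D m v\<bar> / (2 * (min 1 \<bar>u - v\<bar>) powr \<beta>) \<le> 1)})"

definition p_norm :: "real \<Rightarrow> nat \<Rightarrow> vec \<Rightarrow> real" where
  "p_norm p d a = (\<Sum>i<d. \<bar>a i\<bar> powr p) powr (1 / p)"

text \<open>For \<open>p \<le> 1\<close> the argument of \<open>g\<close> stays in \<open>[-1,1]\<close>, as \<open>\<parallel>a\<parallel>\<^sub>1 \<le> \<parallel>a\<parallel>\<^sub>p = 1\<close>.\<close>

definition ridge_class :: "nat \<Rightarrow> real \<Rightarrow> real \<Rightarrow> (vec \<Rightarrow> real) set" where
  "ridge_class d r p =
    {restrict (\<lambda>x. g (\<Sum>i<d. a i * x i)) (cube d) | g a. g \<in> lip_ball r \<and> p_norm p d a = 1}"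

lemma topspace_cube_top: "topspace (cube_top d) = cube d"
  by (simp add: cube_top_def cube_def)

lemma mdist_C_cube:
  assumes "f \<in> mspace (C_cube d)" "h \<in> mspace (C_cube d)"
  shows "mdist (C_cube d) f h = (SUP x\<in>cube d. \<bar>f x - h x\<bar>)"
proof -
  have "cube d \<noteq> {}"
    by (auto simp: cube_def PiE_eq_empty_iff)
  with assms show ?thesis
    by (auto simp: C_cube_def cfunspace_def mdist_submetric topspace_cube_top
        Met_TC.fdist_def Met_TC.fspace_def dist_real_def)
qed

lemma continuous_on_lip_ball:
  assumes "g \<in> lip_ball r"
  shows "continuous_on {-1..1} g"
proof -
  obtain D :: "nat \<Rightarrow> real \<Rightarrow> real" where D: "\<forall>t\<in>{-1..1}. D 0 t = g t"
    "\<forall>k<lip_order r. \<forall>t\<in>{-1..1}. (D k has_real_derivative D (Suc k) t) (at t within {-1..1})"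
    "continuous_on {-1..1} (D (lip_order r))"
    using assms by (auto simp: lip_ball_def Let_def)
  have "continuous_on {-1..1} (D 0)"
  proof (cases "lip_order r = 0")
    case True
    with D show ?thesis by simp
  next
    case False
    with D(2) have "\<forall>t\<in>{-1..1}. (D 0 has_real_derivative D (Suc 0) t) (at t within {-1..1})"
      by simp
    then show ?thesis
      by (meson DERIV_continuous continuous_on_eq_continuous_within)
  qed
  then show ?thesis
    by (rule continuous_on_eq) (use D(1) in blast)
qed

lemma ridge_argument:
  assumes p: "0 < p" "p \<le> 1" and a: "p_norm p d a = 1" and x: "x \<in> cube d"
  shows "(\<Sum>i<d. a i * x i) \<in> {-1..1}"
proof -
  have s: "(\<Sum>i<d. \<bar>a i\<bar> powr p) = 1"
  proof -
    have "0 \<le> (\<Sum>i<d. \<bar>a i\<bar> powr p)"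
      by (intro sum_nonneg) auto
    then have "(\<Sum>i<d. \<bar>a i\<bar> powr p) = ((\<Sum>i<d. \<bar>a i\<bar> powr p) powr (1 / p)) powr p"
      using p by (simp add: powr_powr)
    then show ?thesis
      using a by (simp add: p_norm_def)
  qed
  have le: "\<bar>a i\<bar> \<le> \<bar>a i\<bar> powr p" if "i < d" for i
  proof -
    have "\<bar>a i\<bar> powr p \<le> 1"
      using member_le_sum[of i "{..<d}" "\<lambda>i. \<bar>a i\<bar> powr p"] that s by simp
    then have "\<bar>a i\<bar> \<le> 1"
      using gr_one_powr[of "\<bar>a i\<bar>" p] p by linarith
    then show ?thesis
      using p powr_mono'[of p 1 "\<bar>a i\<bar>"] by simp
  qed
  have "\<bar>\<Sum>i<d. a i * x i\<bar> \<le> (\<Sum>i<d. \<bar>a i * x i\<bar>)"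
    by (rule sum_abs)
  also have "\<dots> \<le> (\<Sum>i<d. \<bar>a i\<bar> powr p)"
  proof (rule sum_mono)
    fix i assume "i \<in> {..<d}"
    then have i: "i < d" by simp
    have "\<bar>x i\<bar> \<le> 1"
      using PiE_mem[OF x[unfolded cube_def], of i] i by auto
    then have "\<bar>a i * x i\<bar> \<le> \<bar>a i\<bar>"
      by (simp add: abs_mult mult_left_le)
    with le[OF i] show "\<bar>a i * x i\<bar> \<le> \<bar>a i\<bar> powr p" by linarith
  qed
  finally show ?thesis
    using s by auto
qed

lemma ridge_class_subset:
  assumes p: "0 < p" "p \<le> 1"
  shows "ridge_class d r p \<subseteq> mspace (C_cube d)"
proof
  fix f assume "f \<in> ridge_class d r p"
  then obtain g a where g: "g \<in> lip_ball r" and a: "p_norm p d a = 1"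
    and f: "f = restrict (\<lambda>x. g (\<Sum>i<d. a i * x i)) (cube d)"
    by (auto simp: ridge_class_def)
  have proj: "continuous_map (cube_top d) euclideanreal (\<lambda>x. x i)" if "i < d" for i
  proof -
    have "continuous_map (cube_top d) (top_of_set {-1..1}) (\<lambda>x. x i)"
      unfolding cube_top_def by (rule continuous_map_product_projection) (use that in simp)
    then show ?thesis
      by (simp add: continuous_map_in_subtopology)
  qed
  have "continuous_map (cube_top d) (top_of_set {-1..1}) (\<lambda>x. \<Sum>i<d. a i * x i)"
    using ridge_argument[OF p a]
    by (auto simp: continuous_map_in_subtopology topspace_cube_top
        intro!: continuous_map_sum continuous_map_real_mult_left proj)
  moreover have "continuous_map (top_of_set {-1..1}) euclideanreal g"
    using continuous_on_lip_ball[OF g] by simp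
  ultimately have "continuous_map (cube_top d) euclideanreal (g \<circ> (\<lambda>x. \<Sum>i<d. a i * x i))"
    by (rule continuous_map_compose)
  then have cont: "continuous_map (cube_top d) euclideanreal f"
    by (rule continuous_map_eq) (simp add: f topspace_cube_top)
  have "compact_space (cube_top d)"
    unfolding cube_top_def by (simp add: compact_space_product_topology compact_space_subtopology)
  then have "compactin euclideanreal (f ` cube d)"
    using image_compactin[OF _ cont] by (metis compact_space_def topspace_cube_top)
  then have "bounded (f ` cube d)"
    by (simp add: compact_imp_bounded)
  with cont show "f \<in> mspace (C_cube d)"
    by (auto simp: C_cube_def cfunspace_def topspace_cube_top f Met_TC.fspace_def)
qed

section \<open>Randomized algorithms\<close>

text \<open>
  \<open>observed L f \<omega> i\<close> is the vector of the first \<open>i\<close> function values, and \<open>sample_point L f \<omega> i\<close> is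
  \<open>X\<^bsub>i+1\<^esub>(\<omega>)\<close>. The first point is the value of \<open>L 0 \<omega>\<close> at the unique element of \<open>\<real>\<^sup>0\<close> and so does
  not depend on \<open>f\<close>.
\<close>

primrec observed :: "(nat \<Rightarrow> 'w \<Rightarrow> vec \<Rightarrow> vec) \<Rightarrow> (vec \<Rightarrow> real) \<Rightarrow> 'w \<Rightarrow> nat \<Rightarrow> vec" where
  "observed L f \<omega> 0 = (\<lambda>_. undefined)"
| "observed L f \<omega> (Suc i) = (observed L f \<omega> i)(i := f (L i \<omega> (observed L f \<omega> i)))"

definition sample_point ::
    "(nat \<Rightarrow> 'w \<Rightarrow> vec \<Rightarrow> vec) \<Rightarrow> (vec \<Rightarrow> real) \<Rightarrow> 'w \<Rightarrow> nat \<Rightarrow> vec" where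
  "sample_point L f \<omega> i = L i \<omega> (observed L f \<omega> i)"

definition algorithm_output ::
    "nat \<Rightarrow> (nat \<Rightarrow> 'w \<Rightarrow> vec \<Rightarrow> vec) \<Rightarrow> ('w \<Rightarrow> vec \<Rightarrow> vec \<Rightarrow> real) \<Rightarrow> 'w \<Rightarrow> (vec \<Rightarrow> real) \<Rightarrow> vec \<Rightarrow> real"
  where "algorithm_output n L \<phi> \<omega> f = \<phi> \<omega> (observed L f \<omega> n)"

text \<open>
  Separate measurability of \<open>\<phi>\<close> in its two arguments does not make \<open>\<omega> \<mapsto> \<parallel>f - S\<^sub>n(\<omega>, f)\<parallel>\<^sub>\<infinity>\<close>
  measurable. The last condition says that it is, so that \<open>\<bbbE> \<parallel>f - S\<^sub>n(f)\<parallel>\<^sub>\<infinity>\<^sup>2\<close> is defined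
  (\<^const>\<open>nn_integral\<close> of a non-measurable function is only a lower integral).
\<close>

definition randomized_algorithm ::
    "'w measure \<Rightarrow> nat \<Rightarrow> nat \<Rightarrow> (vec \<Rightarrow> real) set \<Rightarrow>
      (nat \<Rightarrow> 'w \<Rightarrow> vec \<Rightarrow> vec) \<Rightarrow> ('w \<Rightarrow> vec \<Rightarrow> vec \<Rightarrow> real) \<Rightarrow> bool" where
  "randomized_algorithm M n d F L \<phi> \<longleftrightarrow>
     prob_space M \<and>
     (\<forall>i<n. \<forall>\<omega>\<in>space M. L i \<omega> \<in> vec_borel i \<rightarrow>\<^sub>M cube_borel d) \<and>
     (\<forall>f\<in>F. \<forall>i<n. (\<lambda>\<omega>. sample_point L f \<omega> i) \<in> M \<rightarrow>\<^sub>M cube_borel d) \<and>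
     (\<forall>y\<in>space (vec_borel n). (\<lambda>\<omega>. \<phi> \<omega> y) \<in> M \<rightarrow>\<^sub>M C_borel d) \<and>
     (\<forall>\<omega>\<in>space M. \<phi> \<omega> \<in> vec_borel n \<rightarrow>\<^sub>M C_borel d) \<and>
     (\<forall>f\<in>F. (\<lambda>\<omega>. mdist (C_cube d) f (algorithm_output n L \<phi> \<omega> f)) \<in> borel_measurable M)"

definition ennreal_sqrt :: "ennreal \<Rightarrow> ennreal" where
  "ennreal_sqrt x = (if x = \<infinity> then \<infinity> else ennreal (sqrt (enn2real x)))"

definition worst_case_error ::
    "'w measure \<Rightarrow> nat \<Rightarrow> nat \<Rightarrow> (vec \<Rightarrow> real) set \<Rightarrow>
      (nat \<Rightarrow> 'w \<Rightarrow> vec \<Rightarrow> vec) \<Rightarrow> ('w \<Rightarrow> vec \<Rightarrow> vec \<Rightarrow> real) \<Rightarrow> ennreal" where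
  "worst_case_error M n d F L \<phi> =
     (SUP f\<in>F. ennreal_sqrt
        (\<integral>\<^sup>+\<omega>. ennreal ((mdist (C_cube d) f (algorithm_output n L \<phi> \<omega> f))\<^sup>2) \<partial>M))"

text \<open>Infimum over the algorithms on probability spaces whose points have type \<open>'w\<close>.\<close>

definition err_ran_on :: "'w itself \<Rightarrow> nat \<Rightarrow> nat \<Rightarrow> (vec \<Rightarrow> real) set \<Rightarrow> ennreal" where
  "err_ran_on _ n d F =
     Inf {worst_case_error M n d F L \<phi> | (M :: 'w measure) L \<phi>. randomized_algorithm M n d F L \<phi>}"

text \<open>
  A formula cannot quantify over types, and a constant obtained for each \<open>'w\<close> separately might
  depend on \<open>'w\<close>. The sample points of \<open>err_ran\<close> are therefore themselves pairs of maps
  \<open>(L(\<omega>,\<cdot>), \<phi>(\<omega>,\<cdot>))\<close>, with any \<open>\<sigma>\<close>-algebra and any probability measure. The lemma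
  \<open>err_ran_le_err_ran_on\<close> shows that this loses no algorithm: \<open>err_ran\<close> is the infimum over all
  probability spaces, of whatever type.
\<close>

type_synonym realization = "(nat \<Rightarrow> vec \<Rightarrow> vec) \<times> (vec \<Rightarrow> vec \<Rightarrow> real)"

definition err_ran :: "nat \<Rightarrow> nat \<Rightarrow> (vec \<Rightarrow> real) set \<Rightarrow> ennreal" where
  "err_ran n d F = err_ran_on TYPE(realization) n d F"

lemma randomized_algorithm_realization:
  fixes M :: "'w measure"
  assumes alg: "randomized_algorithm M n d F L \<phi>"
  obtains M' :: "realization measure" and L' \<phi>'
  where "randomized_algorithm M' n d F L' \<phi>'"
    and "worst_case_error M' n d F L' \<phi>' = worst_case_error M n d F L \<phi>"
proof -
  define T :: "'w \<Rightarrow> realization" where "T \<omega> = (\<lambda>i. L i \<omega>, \<phi> \<omega>)" for \<omega>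
  define N where "N = sigma (T ` space M) {A. A \<subseteq> T ` space M \<and> T -` A \<inter> space M \<in> sets M}"
  define M' where "M' = distr M N T"
  define L' :: "nat \<Rightarrow> realization \<Rightarrow> vec \<Rightarrow> vec" where "L' i z = fst z i" for i z
  define \<phi>' :: "realization \<Rightarrow> vec \<Rightarrow> vec \<Rightarrow> real" where "\<phi>' z = snd z" for z
  have spN: "space N = T ` space M"
    unfolding N_def by (rule space_measure_of) auto
  have T: "T \<in> M \<rightarrow>\<^sub>M N"
    unfolding N_def by (rule measurable_measure_of) auto
  have spM': "space M' = T ` space M"
    by (simp add: M'_def spN)
  have lift: "h \<in> N \<rightarrow>\<^sub>M K" if h: "(\<lambda>\<omega>. h (T \<omega>)) \<in> M \<rightarrow>\<^sub>M K"
    for h :: "realization \<Rightarrow> 'k" and K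
  proof (rule measurableI)
    show "h z \<in> space K" if "z \<in> space N" for z
      using that measurable_space[OF h] by (auto simp: spN)
    fix B assume B: "B \<in> sets K"
    have "T -` (h -` B \<inter> space N) \<inter> space M = (\<lambda>\<omega>. h (T \<omega>)) -` B \<inter> space M"
      by (auto simp: spN)
    then have "h -` B \<inter> space N \<in> {A. A \<subseteq> T ` space M \<and> T -` A \<inter> space M \<in> sets M}"
      using measurable_sets[OF h B] by (auto simp: spN)
    then show "h -` B \<inter> space N \<in> sets N"
      unfolding N_def by (subst sets_measure_of) (auto intro: sigma_sets.Basic)
  qed
  have obs: "observed L' f (T \<omega>) i = observed L f \<omega> i" for f \<omega> i
    by (induction i) (simp_all add: L'_def T_def)
  have pt: "sample_point L' f (T \<omega>) i = sample_point L f \<omega> i" for f \<omega> i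
    unfolding sample_point_def obs by (simp add: L'_def T_def)
  have out: "algorithm_output n L' \<phi>' (T \<omega>) f = algorithm_output n L \<phi> \<omega> f" for f \<omega>
    unfolding algorithm_output_def obs by (simp add: \<phi>'_def T_def)
  have meas: "(\<lambda>z. mdist (C_cube d) f (algorithm_output n L' \<phi>' z f)) \<in> borel_measurable N"
    if "f \<in> F" for f
    using alg that by (intro lift) (simp add: out randomized_algorithm_def)
  interpret prob_space M
    using alg by (simp add: randomized_algorithm_def)
  have M'1: "randomized_algorithm M' n d F L' \<phi>'"
    unfolding randomized_algorithm_def
  proof (intro conjI ballI allI impI)
    show "prob_space M'"
      unfolding M'_def by (rule prob_space_distr[OF T])
    show "L' i z \<in> vec_borel i \<rightarrow>\<^sub>M cube_borel d" if "i < n" "z \<in> space M'" for i z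
      using that alg by (auto simp: spM' L'_def T_def randomized_algorithm_def)
    show "(\<lambda>z. sample_point L' f z i) \<in> M' \<rightarrow>\<^sub>M cube_borel d" if "f \<in> F" "i < n" for f i
      unfolding M'_def measurable_distr_eq1
      using that alg by (intro lift) (simp add: pt randomized_algorithm_def)
    show "(\<lambda>z. \<phi>' z y) \<in> M' \<rightarrow>\<^sub>M C_borel d" if "y \<in> space (vec_borel n)" for y
      unfolding M'_def measurable_distr_eq1
      using that alg by (intro lift) (simp add: \<phi>'_def T_def randomized_algorithm_def)
    show "\<phi>' z \<in> vec_borel n \<rightarrow>\<^sub>M C_borel d" if "z \<in> space M'" for z
      using that alg by (auto simp: spM' \<phi>'_def T_def randomized_algorithm_def)
    show "(\<lambda>z. mdist (C_cube d) f (algorithm_output n L' \<phi>' z f)) \<in> borel_measurable M'"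
      if "f \<in> F" for f
      unfolding M'_def measurable_distr_eq1 by (rule meas[OF that])
  qed
  have "(\<integral>\<^sup>+z. ennreal ((mdist (C_cube d) f (algorithm_output n L' \<phi>' z f))\<^sup>2) \<partial>M') =
        (\<integral>\<^sup>+\<omega>. ennreal ((mdist (C_cube d) f (algorithm_output n L \<phi> \<omega> f))\<^sup>2) \<partial>M)"
    if "f \<in> F" for f
    unfolding M'_def
    by (subst nn_integral_distr[OF T]) (use meas[OF that] in \<open>measurable, simp add: out\<close>)
  then have "worst_case_error M' n d F L' \<phi>' = worst_case_error M n d F L \<phi>"
    unfolding worst_case_error_def by (intro SUP_cong) auto
  with M'1 show thesis by (rule that)
qed

lemma err_ran_le_err_ran_on: "err_ran n d F \<le> err_ran_on TYPE('w) n d F"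
  unfolding err_ran_def err_ran_on_def
proof (rule Inf_greatest, clarify)
  fix M :: "'w measure" and L \<phi>
  assume "randomized_algorithm M n d F L \<phi>"
  then obtain M' :: "realization measure" and L' \<phi>'
    where "randomized_algorithm M' n d F L' \<phi>'"
      and eq: "worst_case_error M' n d F L' \<phi>' = worst_case_error M n d F L \<phi>"
    by (rule randomized_algorithm_realization)
  then show "Inf {worst_case_error M n d F L \<phi> | (M :: realization measure) L \<phi>.
      randomized_algorithm M n d F L \<phi>} \<le> worst_case_error M n d F L \<phi>"
    by (intro Inf_lower) (auto simp flip: eq)
qed

end

theory Submission
  imports Defs
begin

text \<open>
  The lower bound comes from a large family of ridge functions that look like the zero function at
  almost every point of the cube. Fix \<open>k \<le> d\<close> and spread the direction evenly over the first \<open>k\<close>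
  coordinates: for a sign vector \<open>\<epsilon>\<close> of length \<open>k\<close>, the vector \<open>k powr (- 1 / p) \<epsilon>\<close> has \<open>p\<close>-norm 1, and its inner
  product with points of the cube is at most \<open>k powr (1 - 1 / p)\<close>, attained at \<open>x = \<epsilon>\<close>. The profile \<open>g\<close> is a
  multiple of the truncated power \<open>(t - \<tau>)\<^sub>+\<^sup>r\<close> whose threshold \<open>\<tau>\<close> is half of that maximum. Up to a
  factor that depends on \<open>r\<close> alone it lies in the Lipschitz ball
  (\<open>scaled_truncated_power_in_lip_ball\<close>), and the sup norm of the resulting ridge function is a
  constant times \<open>\<tau>\<^sup>r\<close>.

  A point \<open>x\<close> of the cube can tell this function from zero only if \<open>\<epsilon>\<^sub>1 x\<^sub>1 + \<dots> + \<epsilon>\<^sub>k x\<^sub>k > k/2\<close>. By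
  Hoeffding's bound this holds for a fraction of at most \<open>exp (- k/8)\<close> of the sign vectors
  (\<open>card_correlated_signs_le\<close>). Run an algorithm on the zero function: for each realization of
  its randomness, the \<open>n\<close> points that it samples miss at least half of the family, provided that
  \<open>n exp (- k/8) \<le> 1/2\<close>. On a missed function the algorithm sees the same data, hence, even when
  it chooses its points adaptively, it returns the same output as on zero, and this output is far
  from one of the two. Averaging over the family and over the randomness bounds the error from
  below by a quarter of the common norm (\<open>err_ran_ge_of_indistinguishable\<close>).

  It remains to choose \<open>k\<close> hardly larger than this condition demands:
  \<open>k = \<lceil>8 ln (2 (n + 1))\<rceil>\<close>. The hypothesis on \<open>n\<close> gives \<open>k \<le> d\<close>.
\<close>

section \<open>Sign vectors correlated with a given point of the cube\<close>

definition sign_vectors :: "nat \<Rightarrow> vec set" where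
  "sign_vectors k = {..<k} \<rightarrow>\<^sub>E {-1, 1}"

lemma finite_sign_vectors: "finite (sign_vectors k)"
  unfolding sign_vectors_def by (intro finite_PiE) auto

lemma card_sign_vectors: "card (sign_vectors k) = 2 ^ k"
  unfolding sign_vectors_def by (simp add: card_PiE numeral_2_eq_2)

text \<open>The analytic core of Hoeffding's lemma, for a fair sign.\<close>

lemma cosh_le_exp_half_square: "cosh u \<le> exp (u\<^sup>2 / 2)" for u :: real
proof -
  have *: "cosh u \<le> exp (u\<^sup>2 / 2)" if u: "0 \<le> u" for u :: real
  proof -
    have "- u + ln (1 + (1/2) * (exp (2 * u) - 1)) \<le> u\<^sup>2 / 2"
      using Hoeffdings_lemma_aux[of "2 * u" "1/2"] u by (simp add: power2_eq_square)
    moreover have "1 + (1/2) * (exp (2 * u) - 1) = exp u * cosh u"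
      by (simp add: cosh_field_def field_simps flip: exp_add)
    ultimately have "ln (cosh u) \<le> u\<^sup>2 / 2"
      by (simp add: ln_mult)
    then show ?thesis
      by (metis cosh_real_pos exp_le_cancel_iff exp_ln)
  qed
  show ?thesis
    using *[of "\<bar>u\<bar>"] by (simp add: cosh_real_abs)
qed

text \<open>
  Hoeffding's inequality for independent fair signs, in counting form. It is the Chernoff argument:
  the average of \<open>exp (\<lambda> (\<epsilon>\<^sub>1 x\<^sub>1 + \<dots> + \<epsilon>\<^sub>k x\<^sub>k))\<close> factorizes into hyperbolic cosines, each at most
  \<open>exp (\<lambda>\<^sup>2/2)\<close>. For the threshold \<open>k/2\<close> the best exponent is \<open>\<lambda> = 1/2\<close>.
\<close>

lemma card_correlated_signs_le:
  fixes x :: vec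
  assumes x: "\<And>i. i < k \<Longrightarrow> \<bar>x i\<bar> \<le> 1"
  shows "real (card {\<epsilon> \<in> sign_vectors k. (\<Sum>i<k. \<epsilon> i * x i) > real k / 2})
           \<le> exp (- real k / 8) * real (card (sign_vectors k))"
    (is "real (card ?B) \<le> _")
proof -
  have "real (card ?B) * exp (real k / 4) = (\<Sum>\<epsilon>\<in>?B. exp (real k / 4))"
    by simp
  also have "\<dots> \<le> (\<Sum>\<epsilon>\<in>?B. exp ((\<Sum>i<k. \<epsilon> i * x i) / 2))"
    by (intro sum_mono) auto
  also have "\<dots> \<le> (\<Sum>\<epsilon>\<in>sign_vectors k. exp ((\<Sum>i<k. \<epsilon> i * x i) / 2))"
    by (intro sum_mono2 finite_sign_vectors) auto
  also have "\<dots> = (\<Sum>\<epsilon>\<in>sign_vectors k. \<Prod>i<k. exp (\<epsilon> i * x i / 2))"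
    by (simp add: exp_sum sum_divide_distrib)
  also have "\<dots> = (\<Prod>i<k. \<Sum>e\<in>{-1, 1}. exp (e * x i / 2))"
    unfolding sign_vectors_def by (subst prod_sum_PiE) auto
  also have "\<dots> \<le> (\<Prod>i<k. 2 * exp (1 / 8))"
  proof (intro prod_mono conjI)
    fix i assume "i \<in> {..<k}"
    then have "(x i)\<^sup>2 \<le> 1"
      using x[of i] by (simp add: abs_square_le_1)
    then have "cosh (x i / 2) \<le> exp (1 / 8)"
      using cosh_le_exp_half_square[of "x i / 2"]
      by (simp add: power_divide) (smt (verit) exp_le_cancel_iff divide_right_mono)
    then show "(\<Sum>e\<in>{-1, 1}. exp (e * x i / 2)) \<le> 2 * exp (1 / 8)"
      by (simp add: cosh_field_def)
  qed (auto intro: sum_nonneg)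
  also have "\<dots> = real (card (sign_vectors k)) * exp (real k / 8)"
    by (simp add: card_sign_vectors power_mult_distrib flip: exp_of_nat_mult)
  finally have "real (card ?B) \<le> real (card (sign_vectors k)) * exp (real k / 8) / exp (real k / 4)"
    by (simp add: pos_le_divide_eq)
  also have "\<dots> = real (card (sign_vectors k)) * exp (real k / 8 - real k / 4)"
    by (simp only: exp_diff times_divide_eq_right)
  also have "real k / 8 - real k / 4 = - real k / 8"
    by simp
  finally show ?thesis
    by (simp add: mult.commute)
qed

section \<open>Truncated powers in the Lipschitz ball\<close>

definition truncated_power :: "real \<Rightarrow> real \<Rightarrow> real \<Rightarrow> real" where
  "truncated_power \<tau> e t = max 0 (t - \<tau>) powr e"

text \<open>
  For an exponent above 1 the two branches join differentiably at \<open>\<tau>\<close>, because the difference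
  quotient there has absolute value at most \<open>\<bar>h\<bar> powr (e - 1)\<close>.
\<close>

lemma has_real_derivative_truncated_power:
  assumes e: "1 < e"
  shows "(truncated_power \<tau> e has_real_derivative e * truncated_power \<tau> (e - 1) t) (at t)"
proof -
  consider "t < \<tau>" | "t = \<tau>" | "\<tau> < t" by linarith
  then show ?thesis
  proof cases
    case 1
    have "((\<lambda>_. 0) has_real_derivative e * truncated_power \<tau> (e - 1) t) (at t)"
      using 1 by (simp add: truncated_power_def)
    then show ?thesis
      by (rule has_field_derivative_transform_within_open[where S = "{..<\<tau>}"])
        (use 1 in \<open>auto simp: truncated_power_def\<close>)
  next
    case 2
    have "((\<lambda>h. \<bar>h\<bar> powr (e - 1)) \<longlongrightarrow> 0) (at (0::real))"
      by (rule tendsto_zero_powrI[where b = "e - 1"]) (use e in \<open>auto intro!: tendsto_eq_intros\<close>)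
    then have "((\<lambda>h. (truncated_power \<tau> e (\<tau> + h) - truncated_power \<tau> e \<tau>) / h) \<longlongrightarrow> 0) (at 0)"
    proof (rule Lim_null_comparison[rotated], intro always_eventually allI)
      fix h :: real
      show "norm ((truncated_power \<tau> e (\<tau> + h) - truncated_power \<tau> e \<tau>) / h) \<le> \<bar>h\<bar> powr (e - 1)"
        using e by (cases "h > 0")
          (auto simp: truncated_power_def powr_diff max_def intro!: divide_nonneg_nonpos)
    qed
    then show ?thesis
      using 2 e by (simp add: DERIV_def truncated_power_def)
  next
    case 3
    have "((\<lambda>t. (t - \<tau>) powr e) has_real_derivative e * truncated_power \<tau> (e - 1) t) (at t)"
      using 3 by (auto simp: truncated_power_def intro!: derivative_eq_intros)
    then show ?thesis
      by (rule has_field_derivative_transform_within_open[where S = "{\<tau><..}"])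
        (use 3 in \<open>auto simp: truncated_power_def\<close>)
  qed
qed

lemma continuous_on_truncated_power: "0 < e \<Longrightarrow> continuous_on S (truncated_power \<tau> e)"
  unfolding truncated_power_def by (intro continuous_on_powr' continuous_intros) auto

lemma truncated_power_bounds:
  assumes "0 < e" "0 \<le> \<tau>" "t \<le> 1"
  shows "0 \<le> truncated_power \<tau> e t" "truncated_power \<tau> e t \<le> 1"
  using assms powr_mono2[of e "max 0 (t - \<tau>)" 1] by (auto simp: truncated_power_def)

text \<open>
  After scaling to \<open>x + y = 1\<close>, neither summand decreases when it is raised to the power \<open>\<beta> \<le> 1\<close>.
\<close>

lemma powr_add_le:
  fixes x y \<beta> :: real
  assumes "0 \<le> x" "0 \<le> y" "0 < \<beta>" "\<beta> \<le> 1"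
  shows "(x + y) powr \<beta> \<le> x powr \<beta> + y powr \<beta>"
proof (cases "x + y = 0")
  case False
  define s where "s = x + y"
  have s: "s > 0" using False assms by (simp add: s_def)
  have "1 = x / s + y / s"
    using s by (simp add: s_def flip: add_divide_distrib)
  also have "\<dots> \<le> (x / s) powr \<beta> + (y / s) powr \<beta>"
    using s assms powr_mono'[of \<beta> 1 "x / s"] powr_mono'[of \<beta> 1 "y / s"]
    by (intro add_mono) (auto simp: s_def)
  also have "\<dots> = (x powr \<beta> + y powr \<beta>) / s powr \<beta>"
    using s assms by (simp add: powr_divide add_divide_distrib)
  finally show ?thesis
    using s by (simp add: s_def field_simps)
qed (use assms in auto)

text \<open>
  For nearby points this is subadditivity of \<open>t powr \<beta>\<close>; for points at distance above 1 it holds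
  because the values themselves lie in \<open>[0,1]\<close>.
\<close>

lemma truncated_power_holder:
  assumes \<beta>: "0 < \<beta>" "\<beta> \<le> 1" and \<tau>: "0 \<le> \<tau>" and uv: "u \<le> 1" "v \<le> 1"
  shows "\<bar>truncated_power \<tau> \<beta> u - truncated_power \<tau> \<beta> v\<bar> \<le> (min 1 \<bar>u - v\<bar>) powr \<beta>"
proof -
  have *: "\<bar>truncated_power \<tau> \<beta> u - truncated_power \<tau> \<beta> v\<bar> \<le> \<bar>u - v\<bar> powr \<beta>"
    if "v \<le> u" for u v
  proof -
    let ?x = "max 0 (v - \<tau>)" and ?y = "max 0 (u - \<tau>)"
    have "?x powr \<beta> \<le> ?y powr \<beta>"
      using that \<beta> by (intro powr_mono2) auto
    moreover have "?y powr \<beta> \<le> ?x powr \<beta> + (?y - ?x) powr \<beta>"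
      using powr_add_le[of ?x "?y - ?x" \<beta>] that \<beta> by simp
    moreover have "(?y - ?x) powr \<beta> \<le> \<bar>u - v\<bar> powr \<beta>"
      using that \<beta> by (intro powr_mono2) auto
    ultimately show ?thesis
      by (simp add: truncated_power_def)
  qed
  show ?thesis
  proof (cases "\<bar>u - v\<bar> \<le> 1")
    case True
    then show ?thesis
      using *[of u v] *[of v u] by (cases "u \<le> v") (auto simp: abs_minus_commute)
  next
    case False
    then have "min 1 \<bar>u - v\<bar> = 1" by simp
    then show ?thesis
      using truncated_power_bounds[OF \<beta>(1) \<tau> uv(1)] truncated_power_bounds[OF \<beta>(1) \<tau> uv(2)]
      by (auto simp: abs_le_iff)
  qed
qed

lemma lip_order_bounds:
  assumes "0 < r"
  shows "real (lip_order r) < r" "r \<le> real (lip_order r) + 1"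
proof -
  have "1 \<le> \<lceil>r\<rceil>" using assms by (simp add: one_le_ceiling)
  then have "real (lip_order r) = of_int \<lceil>r\<rceil> - 1"
    by (simp add: lip_order_def)
  then show "real (lip_order r) < r" "r \<le> real (lip_order r) + 1"
    by linarith+
qed

lemma zero_in_lip_ball: "(\<lambda>_. 0) \<in> lip_ball r"
  unfolding lip_ball_def Let_def by (auto intro!: exI[of _ "\<lambda>_ _. 0"])

lemma abs_le_one_of_lip_ball:
  assumes "g \<in> lip_ball r" "t \<in> {-1..1}"
  shows "\<bar>g t\<bar> \<le> 1"
proof -
  obtain D :: "nat \<Rightarrow> real \<Rightarrow> real" where "\<forall>t\<in>{-1..1}. D 0 t = g t"
    "\<forall>k\<le>lip_order r. \<forall>t\<in>{-1..1}. \<bar>D k t\<bar> \<le> 1"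
    using assms(1) unfolding lip_ball_def Let_def by blast
  with assms(2) show ?thesis
    by (metis le0)
qed

text \<open>
  Differentiating \<open>k\<close> times lowers the exponent to \<open>r - k\<close> and produces the falling factorial
  \<open>r (r - 1) \<dots> (r - k + 1)\<close>, all of whose factors lie in \<open>[0, 1 + r]\<close> as long as \<open>k \<le> lip_order r\<close>.
  Dividing by \<open>(1 + r) ^ lip_order r\<close> therefore brings all the coefficients into \<open>[0,1]\<close> at once,
  independently of \<open>\<tau>\<close>. At the last step the exponent is \<open>r - lip_order r \<in> (0,1]\<close>, where the
  Hoelder estimate applies.
\<close>

lemma scaled_truncated_power_in_lip_ball:
  assumes r: "0 < r" and \<tau>: "0 \<le> \<tau>"
  shows "(\<lambda>t. truncated_power \<tau> r t / (1 + r) ^ lip_order r) \<in> lip_ball r"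
proof -
  define m where "m = lip_order r"
  have m: "real m < r" "r \<le> real m + 1"
    using lip_order_bounds[OF r] by (auto simp: m_def)
  define c where "c k = (\<Prod>j<k. r - real j) / (1 + r) ^ m" for k
  define D where "D k t = c k * truncated_power \<tau> (r - real k) t" for k t
  have c: "0 \<le> c k" "c k \<le> 1" if "k \<le> m" for k
  proof -
    have le: "real j \<le> r" if "j < k" for j
      using that \<open>k \<le> m\<close> m by linarith
    then show "0 \<le> c k"
      using r by (auto simp: c_def intro!: divide_nonneg_nonneg prod_nonneg)
    have "(\<Prod>j<k. r - real j) \<le> (\<Prod>j<k. 1 + r)"
      by (intro prod_mono) (use le in auto)
    also have "\<dots> \<le> (1 + r) ^ m"
      using that r by (simp add: power_increasing)
    finally show "c k \<le> 1"
      using r by (simp add: c_def)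
  qed
  have "D 0 t = truncated_power \<tau> r t / (1 + r) ^ m" for t
    by (simp add: D_def c_def)
  moreover have "(D k has_real_derivative D (Suc k) t) (at t within {-1..1})" if "k < m" for k t
  proof -
    have "1 < r - real k" using that m by linarith
    from DERIV_cmult[OF has_real_derivative_truncated_power[OF this], of "c k" \<tau> t]
    have "(D k has_real_derivative c k * ((r - real k) * truncated_power \<tau> (r - real k - 1) t)) (at t)"
      by (simp add: D_def[abs_def])
    moreover have "c k * ((r - real k) * truncated_power \<tau> (r - real k - 1) t) = D (Suc k) t"
      by (simp add: D_def c_def diff_diff_eq add.commute)
    ultimately show ?thesis
      by (simp add: has_field_derivative_at_within)
  qed
  moreover have "continuous_on {-1..1} (D m)"
    unfolding D_def[abs_def]
    by (intro continuous_on_mult_left continuous_on_truncated_power) (use m in simp)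
  moreover have "\<bar>D k t\<bar> \<le> 1" if "k \<le> m" "t \<in> {-1..1}" for k t
  proof -
    have "0 < r - real k" using that m by linarith
    from truncated_power_bounds[OF this \<tau>, of t] c[OF that(1)] that(2) show ?thesis
      by (simp add: D_def abs_mult mult_le_one)
  qed
  moreover have "\<bar>D m u - D m v\<bar> / (2 * (min 1 \<bar>u - v\<bar>) powr (r - real m)) \<le> 1"
    if uv: "u \<in> {-1..1}" "v \<in> {-1..1}" "u \<noteq> v" for u v
  proof -
    let ?w = "(min 1 \<bar>u - v\<bar>) powr (r - real m)"
    have "\<bar>D m u - D m v\<bar>
        = c m * \<bar>truncated_power \<tau> (r - real m) u - truncated_power \<tau> (r - real m) v\<bar>"
      using c[of m] by (simp add: D_def abs_mult flip: right_diff_distrib)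
    also have "\<dots> \<le> 1 * ?w"
      using c[of m] m \<tau> uv by (intro mult_mono truncated_power_holder) auto
    finally have "\<bar>D m u - D m v\<bar> \<le> 2 * ?w"
      using powr_ge_zero[of "min 1 \<bar>u - v\<bar>" "r - real m"] by linarith
    moreover have "0 < ?w" using uv by simp
    ultimately show ?thesis by (simp add: divide_le_eq)
  qed
  ultimately show ?thesis
    unfolding lip_ball_def Let_def m_def[symmetric] by blast
qed

section \<open>A lower bound from functions indistinguishable at the sample points\<close>

text \<open>
  Adaptivity does not help: a sampling point depends on the input only through earlier values,
  so two inputs that agree at the points chosen for one of them give the same run.
\<close>

lemma observed_eq:
  assumes "\<And>j. j < i \<Longrightarrow> f (sample_point L z \<omega> j) = z (sample_point L z \<omega> j)"
  shows "observed L f \<omega> i = observed L z \<omega> i"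
  using assms by (induction i) (simp_all add: sample_point_def)

lemma observed_in_space_vec_borel: "observed L f \<omega> i \<in> space (vec_borel i)"
proof (induction i)
  case (Suc i)
  then show ?case
    by (auto simp: vec_borel_def space_PiM PiE_def extensional_def)
qed (simp add: vec_borel_def space_PiM)

lemma space_C_borel: "space (C_borel d) = mspace (C_cube d)"
  unfolding C_borel_def
  by (rule space_measure_of) (use openin_subset[of "mtopology_of (C_cube d)"] in auto)

lemma space_cube_borel: "space (cube_borel d) = cube d"
  by (simp add: cube_borel_def space_PiM space_restrict_space cube_def)

lemma le_square_of_ennreal_sqrt_less:
  assumes "ennreal_sqrt x < ennreal c"
  shows "x \<le> ennreal (c\<^sup>2)"
proof (cases x)
  case (real y)
  with assms have "sqrt y < c"
    by (auto simp: ennreal_sqrt_def ennreal_less_iff)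
  then have "y \<le> c\<^sup>2"
    by (simp add: sqrt_le_D)
  with real show ?thesis
    by (simp add: ennreal_leI)
qed (use assms in \<open>simp add: ennreal_sqrt_def\<close>)

text \<open>
  The randomness is held fixed first. The run on \<open>z\<close> then visits \<open>n\<close> definite points, and by the
  union bound at least half of the family agrees with \<open>z\<close> at all of them. For those members the
  outputs coincide, so the triangle inequality bounds the sum of the two errors by \<open>h\<close> from below,
  and the sum of their squares by \<open>h\<^sup>2/2\<close>. Summing over the family before integrating keeps the
  random set of missed members out of the integral, and only the error functions have to be
  measurable.
\<close>

lemma err_ran_ge_of_indistinguishable:
  fixes f :: "'a \<Rightarrow> vec \<Rightarrow> real"
  assumes F: "F \<subseteq> mspace (C_cube d)"
    and A: "finite A" "A \<noteq> {}" "\<And>a. a \<in> A \<Longrightarrow> f a \<in> F" and z: "z \<in> F"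
    and h: "0 \<le> h" "\<And>a. a \<in> A \<Longrightarrow> h \<le> mdist (C_cube d) (f a) z"
    and q: "\<And>x. x \<in> cube d \<Longrightarrow> real (card {a \<in> A. f a x \<noteq> z x}) \<le> q * real (card A)"
    and nq: "real n * q \<le> 1 / 2"
  shows "ennreal (h / 4) \<le> err_ran n d F"
  unfolding err_ran_def err_ran_on_def
proof (rule Inf_greatest, clarify)
  fix M :: "realization measure" and L \<phi>
  assume alg: "randomized_algorithm M n d F L \<phi>"
  interpret prob_space M
    using alg by (simp add: randomized_algorithm_def)
  define N where "N g \<omega> = mdist (C_cube d) g (algorithm_output n L \<phi> \<omega> g)" for g \<omega>
  have N_meas [measurable]: "N g \<in> borel_measurable M" if "g \<in> F" for g
    using alg that by (simp add: randomized_algorithm_def N_def[abs_def])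
  have cardA: "0 < real (card A)"
    using A by (simp add: card_gt_0_iff)
  have pointwise: "real (card A) * (h\<^sup>2 / 4) \<le> (\<Sum>a\<in>A. (N (f a) \<omega>)\<^sup>2 + (N z \<omega>)\<^sup>2)"
    if \<omega>: "\<omega> \<in> space M" for \<omega>
  proof -
    define X where "X i = sample_point L z \<omega> i" for i
    \<comment> \<open>the members that this realization cannot tell from \<open>z\<close>\<close>
    define G where "G = {a \<in> A. \<forall>i<n. f a (X i) = z (X i)}"
    have X: "X i \<in> cube d" if "i < n" for i
    proof -
      have "L i \<omega> \<in> vec_borel i \<rightarrow>\<^sub>M cube_borel d"
        using alg that \<omega> by (simp add: randomized_algorithm_def)
      from measurable_space[OF this observed_in_space_vec_borel[of L z \<omega> i]]
      show ?thesis
        by (simp add: X_def sample_point_def space_cube_borel)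
    qed
    have out: "algorithm_output n L \<phi> \<omega> g \<in> mspace (C_cube d)" for g
    proof -
      have "\<phi> \<omega> \<in> vec_borel n \<rightarrow>\<^sub>M C_borel d"
        using alg \<omega> by (simp add: randomized_algorithm_def)
      from measurable_space[OF this observed_in_space_vec_borel[of L g \<omega> n]]
      show ?thesis
        by (simp add: algorithm_output_def space_C_borel)
    qed
    have "A - G = (\<Union>i<n. {a \<in> A. f a (X i) \<noteq> z (X i)})"
      by (auto simp: G_def)
    then have "card (A - G) \<le> (\<Sum>i<n. card {a \<in> A. f a (X i) \<noteq> z (X i)})"
      using card_UN_le[of "{..<n}" "\<lambda>i. {a \<in> A. f a (X i) \<noteq> z (X i)}"] by simp
    then have "real (card (A - G)) \<le> (\<Sum>i<n. real (card {a \<in> A. f a (X i) \<noteq> z (X i)}))"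
      by (simp only: of_nat_sum[symmetric] of_nat_le_iff)
    also have "\<dots> \<le> (\<Sum>i<n. q * real (card A))"
      by (intro sum_mono q X) auto
    also have "\<dots> = real n * q * real (card A)"
      by simp
    also have "\<dots> \<le> 1 / 2 * real (card A)"
      by (intro mult_right_mono nq) auto
    finally have "real (card (A - G)) \<le> real (card A) / 2" by simp
    moreover have "card (A - G) = card A - card G" "card G \<le> card A"
      using A(1) by (auto simp: G_def intro!: card_Diff_subset card_mono)
    ultimately have G: "real (card A) / 2 \<le> real (card G)"
      by (simp add: of_nat_diff)
    have good: "h\<^sup>2 / 2 \<le> (N (f a) \<omega>)\<^sup>2 + (N z \<omega>)\<^sup>2" if a: "a \<in> G" for a
    proof -
      have "observed L (f a) \<omega> n = observed L z \<omega> n"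
        using a by (intro observed_eq) (simp add: G_def X_def)
      then have eq: "algorithm_output n L \<phi> \<omega> (f a) = algorithm_output n L \<phi> \<omega> z"
        by (simp add: algorithm_output_def)
      have "a \<in> A" using a by (simp add: G_def)
      then have "h \<le> mdist (C_cube d) (f a) z" by (rule h)
      also have "\<dots> \<le> N (f a) \<omega> + N z \<omega>"
        unfolding N_def eq mdist_commute[of "C_cube d" z]
        using F A(3)[OF \<open>a \<in> A\<close>] z out by (intro mdist_triangle) auto
      finally have "h\<^sup>2 \<le> (N (f a) \<omega> + N z \<omega>)\<^sup>2"
        using h(1) by (rule power_mono)
      also have "\<dots> \<le> 2 * ((N (f a) \<omega>)\<^sup>2 + (N z \<omega>)\<^sup>2)"
        using sum_squares_bound[of "N (f a) \<omega>" "N z \<omega>"] by (simp add: power2_sum)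
      finally show ?thesis by simp
    qed
    have "real (card A) * (h\<^sup>2 / 4) = (real (card A) / 2) * (h\<^sup>2 / 2)"
      by simp
    also have "\<dots> \<le> real (card G) * (h\<^sup>2 / 2)"
      by (intro mult_right_mono G) auto
    also have "\<dots> \<le> (\<Sum>a\<in>G. (N (f a) \<omega>)\<^sup>2 + (N z \<omega>)\<^sup>2)"
      using sum_mono[of G "\<lambda>_. h\<^sup>2 / 2", OF good] by simp
    also have "\<dots> \<le> (\<Sum>a\<in>A. (N (f a) \<omega>)\<^sup>2 + (N z \<omega>)\<^sup>2)"
      using A(1) by (intro sum_mono2) (auto simp: G_def)
    finally show ?thesis .
  qed
  show "ennreal (h / 4) \<le> worst_case_error M n d F L \<phi>"
  proof (rule ccontr)
    assume "\<not> ennreal (h / 4) \<le> worst_case_error M n d F L \<phi>"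
    then have less: "worst_case_error M n d F L \<phi> < ennreal (h / 4)"
      by simp
    have I: "(\<integral>\<^sup>+\<omega>. ennreal ((N g \<omega>)\<^sup>2) \<partial>M) \<le> ennreal ((h / 4)\<^sup>2)" if "g \<in> F" for g
    proof (rule le_square_of_ennreal_sqrt_less)
      have "ennreal_sqrt (\<integral>\<^sup>+\<omega>. ennreal ((N g \<omega>)\<^sup>2) \<partial>M) \<le> worst_case_error M n d F L \<phi>"
        unfolding worst_case_error_def N_def by (rule SUP_upper[OF that])
      with less show "ennreal_sqrt (\<integral>\<^sup>+\<omega>. ennreal ((N g \<omega>)\<^sup>2) \<partial>M) < ennreal (h / 4)"
        by (rule le_less_trans[rotated])
    qed
    \<comment> \<open>The average of the two squared errors over the family is then at most \<open>h\<^sup>2/8\<close>, against the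
      pointwise lower bound \<open>h\<^sup>2/4\<close>.\<close>
    have "0 < h"
      using less h(1) by (cases "h = 0") auto
    have "ennreal (real (card A) * (h\<^sup>2 / 4))
        = (\<integral>\<^sup>+\<omega>. ennreal (real (card A) * (h\<^sup>2 / 4)) \<partial>M)"
      by (simp add: emeasure_space_1)
    also have "\<dots> \<le> (\<integral>\<^sup>+\<omega>. (\<Sum>a\<in>A. ennreal ((N (f a) \<omega>)\<^sup>2) + ennreal ((N z \<omega>)\<^sup>2)) \<partial>M)"
    proof (rule nn_integral_mono)
      fix \<omega> assume "\<omega> \<in> space M"
      from ennreal_leI[OF pointwise[OF this]]
      show "ennreal (real (card A) * (h\<^sup>2 / 4))
          \<le> (\<Sum>a\<in>A. ennreal ((N (f a) \<omega>)\<^sup>2) + ennreal ((N z \<omega>)\<^sup>2))"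
        by (simp add: sum_ennreal flip: ennreal_plus)
    qed
    also have "\<dots> = (\<Sum>a\<in>A. (\<integral>\<^sup>+\<omega>. ennreal ((N (f a) \<omega>)\<^sup>2) \<partial>M) + (\<integral>\<^sup>+\<omega>. ennreal ((N z \<omega>)\<^sup>2) \<partial>M))"
      using A(3) z by (subst nn_integral_sum) (auto intro!: sum.cong nn_integral_add)
    also have "\<dots> \<le> (\<Sum>a\<in>A. ennreal ((h / 4)\<^sup>2) + ennreal ((h / 4)\<^sup>2))"
      by (intro sum_mono add_mono I A(3) z)
    also have "\<dots> = ennreal (\<Sum>a\<in>A. (h / 4)\<^sup>2 + (h / 4)\<^sup>2)"
      by (simp add: sum_ennreal del: sum_constant flip: ennreal_plus)
    also have "\<dots> = ennreal (real (card A) * (h\<^sup>2 / 8))"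
      by (simp add: power_divide)
    finally have "real (card A) * (h\<^sup>2 / 4) \<le> real (card A) * (h\<^sup>2 / 8)"
      by (subst (asm) ennreal_le_iff) auto
    with cardA \<open>0 < h\<close> show False
      by simp
  qed
qed

section \<open>Ridge profiles along sign vectors\<close>

definition flat_direction :: "real \<Rightarrow> nat \<Rightarrow> vec \<Rightarrow> vec" where
  "flat_direction p k \<epsilon> i = (if i < k then real k powr (- 1 / p) * \<epsilon> i else 0)"

lemma sum_lessThan_if:
  fixes g :: "nat \<Rightarrow> real"
  assumes "k \<le> d"
  shows "(\<Sum>i<d. if i < k then g i else 0) = (\<Sum>i<k. g i)"
proof -
  have "{..<d} \<inter> {i. i < k} = {..<k}" using assms by auto
  then show ?thesis by (simp add: sum.If_cases)
qed

lemma flat_direction_inner: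
  assumes "k \<le> d"
  shows "(\<Sum>i<d. flat_direction p k \<epsilon> i * x i) = real k powr (- 1 / p) * (\<Sum>i<k. \<epsilon> i * x i)"
proof -
  have "(\<Sum>i<d. flat_direction p k \<epsilon> i * x i)
      = (\<Sum>i<d. if i < k then real k powr (- 1 / p) * (\<epsilon> i * x i) else 0)"
    by (intro sum.cong) (auto simp: flat_direction_def)
  with sum_lessThan_if[OF assms] show ?thesis
    by (simp add: sum_distrib_left)
qed

lemma abs_sign_vector:
  assumes "\<epsilon> \<in> sign_vectors k" "i < k"
  shows "\<bar>\<epsilon> i\<bar> = 1"
  using PiE_mem[OF assms(1)[unfolded sign_vectors_def], of i] assms(2) by auto

lemma p_norm_flat_direction:
  assumes "0 < p" "0 < k" "k \<le> d" "\<epsilon> \<in> sign_vectors k"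
  shows "p_norm p d (flat_direction p k \<epsilon>) = 1"
proof -
  have "(real k powr (- 1 / p)) powr p = real k powr (- 1)"
    using assms unfolding powr_powr by simp
  then have "(real k powr (- 1 / p)) powr p = 1 / real k"
    using assms by (simp add: powr_minus_divide)
  then have "(\<Sum>i<d. \<bar>flat_direction p k \<epsilon> i\<bar> powr p) = (\<Sum>i<d. if i < k then 1 / real k else 0)"
    using abs_sign_vector[OF assms(4)]
    by (intro sum.cong) (auto simp: flat_direction_def abs_mult)
  also have "\<dots> = 1"
    using assms by (simp add: sum_lessThan_if)
  finally show ?thesis
    by (simp add: p_norm_def)
qed

text \<open>
  The member of the family with sign vector \<open>\<epsilon>\<close> has the argument \<open>2 \<tau>\<close> at the point whose first \<open>k\<close>
  coordinates are \<open>\<epsilon>\<close>, which gives its distance from zero. At a point where the signed sum is at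
  most \<open>k/2\<close>, its argument is at most \<open>\<tau>\<close> and it vanishes.
\<close>

lemma ridge_class_sign_family_bound:
  fixes p r \<tau> :: real and k d n :: nat
  defines "\<tau> \<equiv> real k powr (1 - 1 / p) / 2"
  assumes r: "0 < r" and p: "0 < p" "p \<le> 1" and k: "0 < k" "k \<le> d"
    and nk: "real n * exp (- real k / 8) \<le> 1 / 2"
  shows "ennreal (\<tau> powr r / (1 + r) ^ lip_order r / 4) \<le> err_ran n d (ridge_class d r p)"
proof -
  define g where "g t = truncated_power \<tau> r t / (1 + r) ^ lip_order r" for t
  define f where "f \<epsilon> = restrict (\<lambda>x. g (\<Sum>i<d. flat_direction p k \<epsilon> i * x i)) (cube d)" for \<epsilon>
  define z :: "vec \<Rightarrow> real" where "z = restrict (\<lambda>x. 0) (cube d)"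
  have g: "g \<in> lip_ball r"
    unfolding g_def by (intro scaled_truncated_power_in_lip_ball r) (simp add: \<tau>_def)
  have f_mem: "f \<epsilon> \<in> ridge_class d r p" if "\<epsilon> \<in> sign_vectors k" for \<epsilon>
    using g p_norm_flat_direction[OF p(1) k that] by (auto simp: ridge_class_def f_def)
  have ones: "restrict (\<lambda>_. 1) {..<k} \<in> sign_vectors k"
    by (auto simp: sign_vectors_def)
  then have z_mem: "z \<in> ridge_class d r p"
    using zero_in_lip_ball[of r] p_norm_flat_direction[OF p(1) k ones]
    by (auto simp: ridge_class_def z_def)
  note sub = ridge_class_subset[OF p, of d r]
  have \<tau>: "\<tau> = real k powr (- 1 / p) * (real k / 2)"
    using k by (simp add: \<tau>_def powr_diff powr_minus field_simps)
  have \<tau>_pos: "0 < \<tau>" using k by (simp add: \<tau>_def)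
  show ?thesis
  proof (rule err_ran_ge_of_indistinguishable[where f = f and A = "sign_vectors k" and z = z
        and q = "exp (- real k / 8)"])
    show "sign_vectors k \<noteq> {}" using ones by auto
    show "0 \<le> \<tau> powr r / (1 + r) ^ lip_order r" using r by simp
    fix \<epsilon> assume \<epsilon>: "\<epsilon> \<in> sign_vectors k"
    define x where "x = restrict (\<lambda>i. if i < k then \<epsilon> i else 0) {..<d}"
    have x: "x \<in> cube d"
      using abs_sign_vector[OF \<epsilon>] by (force simp: x_def cube_def abs_le_iff)
    have "(\<Sum>i<k. \<epsilon> i * x i) = (\<Sum>i<k. 1)"
    proof (intro sum.cong refl)
      fix i assume "i \<in> {..<k}"
      then show "\<epsilon> i * x i = 1"
        using abs_sign_vector[OF \<epsilon>, of i] k(2) abs_mult_self_eq[of "\<epsilon> i"] by (simp add: x_def)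
    qed
    then have "f \<epsilon> x = g (2 * \<tau>)"
      using x by (simp add: f_def flat_direction_inner[OF k(2)] \<tau>)
    also have "\<dots> = \<tau> powr r / (1 + r) ^ lip_order r"
      using \<tau>_pos by (simp add: g_def truncated_power_def)
    finally have fx: "f \<epsilon> x = \<tau> powr r / (1 + r) ^ lip_order r" .
    have "bdd_above ((\<lambda>x. \<bar>f \<epsilon> x - z x\<bar>) ` cube d)"
    proof (rule bdd_aboveI2)
      fix y assume y: "y \<in> cube d"
      have "\<bar>g t\<bar> \<le> 1" if "t \<in> {-1..1}" for t
        using abs_le_one_of_lip_ball[OF g that] .
      with ridge_argument[OF p p_norm_flat_direction[OF p(1) k \<epsilon>] y] y
      show "\<bar>f \<epsilon> y - z y\<bar> \<le> 1" by (simp add: f_def z_def)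
    qed
    then have "\<bar>f \<epsilon> x - z x\<bar> \<le> mdist (C_cube d) (f \<epsilon>) z"
      using sub f_mem[OF \<epsilon>] z_mem x by (subst mdist_C_cube) (auto intro: cSUP_upper)
    then show "\<tau> powr r / (1 + r) ^ lip_order r \<le> mdist (C_cube d) (f \<epsilon>) z"
      using x r by (simp add: z_def fx)
  next
    fix x assume x: "x \<in> cube d"
    have "{\<epsilon> \<in> sign_vectors k. f \<epsilon> x \<noteq> z x}
        \<subseteq> {\<epsilon> \<in> sign_vectors k. (\<Sum>i<k. \<epsilon> i * x i) > real k / 2}"
    proof (intro Collect_mono conjI impI; elim conjE)
      fix \<epsilon> assume "f \<epsilon> x \<noteq> z x"
      then have "\<tau> < real k powr (- 1 / p) * (\<Sum>i<k. \<epsilon> i * x i)"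
        using x
        by (auto simp: f_def z_def g_def truncated_power_def flat_direction_inner[OF k(2)] max_def
            split: if_splits)
      then show "(\<Sum>i<k. \<epsilon> i * x i) > real k / 2"
        unfolding \<tau> using k by (subst (asm) mult_less_cancel_left_pos) auto
    qed
    then have "real (card {\<epsilon> \<in> sign_vectors k. f \<epsilon> x \<noteq> z x})
        \<le> real (card {\<epsilon> \<in> sign_vectors k. (\<Sum>i<k. \<epsilon> i * x i) > real k / 2})"
      by (intro of_nat_mono card_mono) (auto simp: finite_sign_vectors)
    also have "real (card {\<epsilon> \<in> sign_vectors k. (\<Sum>i<k. \<epsilon> i * x i) > real k / 2})
        \<le> exp (- real k / 8) * real (card (sign_vectors k))"
    proof (rule card_correlated_signs_le)
      show "\<bar>x i\<bar> \<le> 1" if "i < k" for i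
        using PiE_mem[OF x[unfolded cube_def], of i] that k(2) by (auto simp: abs_le_iff)
    qed
    finally show "real (card {\<epsilon> \<in> sign_vectors k. f \<epsilon> x \<noteq> z x})
        \<le> exp (- real k / 8) * real (card (sign_vectors k))" .
  qed (use sub f_mem z_mem nk finite_sign_vectors in auto)
qed

theorem theorem11:
  fixes r :: real
  assumes "r > 0"
  shows "\<exists>c::real. c > 0 \<and>
    (\<forall>(p::real) (d::nat) (n::nat).
       0 < p \<longrightarrow> p \<le> 1 \<longrightarrow> real n + 1 < exp (real d / 8) / 2 \<longrightarrow>
       err_ran n d (ridge_class d r p) \<ge>
         ennreal (c * (1 / (8 * ln (4 * (real n + 1)))) powr (r * (1 / p - 1))))"
proof (intro exI[of _ "2 powr (- r) / (1 + r) ^ lip_order r / 4"] conjI allI impI)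
  show "0 < 2 powr (- r) / (1 + r) ^ lip_order r / 4"
    using assms by simp
  fix p :: real and d n :: nat
  assume p: "0 < p" "p \<le> 1" and n: "real n + 1 < exp (real d / 8) / 2"
  define l where "l = ln (2 * (real n + 1))"
  define k where "k = nat \<lceil>8 * l\<rceil>"
  define s where "s = r * (1 / p - 1)"
  have "0 < l" by (simp add: l_def)
  then have k: "0 < k" "8 * l \<le> real k" "real k < 8 * l + 1"
    unfolding k_def by (auto simp: of_nat_nat) linarith+
  have "exp l < exp (real d / 8)"
    using n by (simp add: l_def)
  then have "k \<le> d"
    using k(3) by simp
  have "exp (- real k / 8) \<le> exp (- l)"
    using k(2) by simp
  then have "real n * exp (- real k / 8) \<le> real n * exp (- l)"
    by (intro mult_left_mono) auto
  also have "\<dots> \<le> 1 / 2"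
    by (simp add: l_def exp_minus field_simps)
  finally have nk: "real n * exp (- real k / 8) \<le> 1 / 2" .
  \<comment> \<open>Rounding \<open>8 l\<close> up costs at most 1, which is less than the \<open>8 ln 2\<close> gained from the factor 4.\<close>
  have "ln (4 * (real n + 1)) = ln (2::real) + l"
    by (simp add: l_def flip: ln_mult_pos)
  then have kX: "real k \<le> 8 * ln (4 * (real n + 1))"
    using k(3) ln2_ge_two_thirds by linarith
  have "0 \<le> s" using assms p by (simp add: s_def)
  then have "(1 / (8 * ln (4 * (real n + 1)))) powr s \<le> (1 / real k) powr s"
    using k(1) kX by (intro powr_mono2) (auto simp: frac_le)
  moreover have "(real k powr (1 - 1 / p) / 2) powr r = 2 powr (- r) * (1 / real k) powr s"
  proof -
    have "(1 / real k) powr s = real k powr (- s)"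
      using k(1) by (simp add: powr_divide powr_minus_divide)
    also have "- s = (1 - 1 / p) * r"
      by (simp add: s_def algebra_simps)
    finally show ?thesis
      by (simp add: powr_divide powr_powr powr_minus_divide)
  qed
  ultimately have "2 powr (- r) / (1 + r) ^ lip_order r / 4
        * (1 / (8 * ln (4 * (real n + 1)))) powr s
      \<le> (real k powr (1 - 1 / p) / 2) powr r / (1 + r) ^ lip_order r / 4"
    using assms by (simp add: divide_right_mono mult_left_mono)
  then show "ennreal (2 powr (- r) / (1 + r) ^ lip_order r / 4
        * (1 / (8 * ln (4 * (real n + 1)))) powr (r * (1 / p - 1)))
      \<le> err_ran n d (ridge_class d r p)"
    using ridge_class_sign_family_bound[OF assms p k(1) \<open>k \<le> d\<close> nk]
    unfolding s_def by (meson ennreal_leI order_trans)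
qed

end
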